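(* Let $\rho_0\in\mathcal{P}_2(\mathbb{R})$ and $v_0\in L^2(\rho_0)$, let $N_0$ be the optimal map of $\rho_0$, $V_0=v_0\circ N_0$, and $F(x)=\int_0^x V_0(w)\,dw$ for $x\in[0,1]$. Suppose $F(1)=0$ and $F(x)\ge0$ for all $x\in(0,1)$. Let $N_t$ ($t\ge0$) capture the sticky particle solution of the pressureless Euler system originating at $(N_0,V_0)$, and let $N_\infty$ be its limit as $t\to\infty$. Then: 1. On every interval $[a,b)\subset[0,1]$ such that $F(a)=F(b)=0$ and $F>0$ on $(a,b)$, $$N_\infty(x)=\frac{1}{b-a}\int_a^b N_0(w)\,dw \quad\text{for } x\in[a,b).$$ 2. On every interval $[c,d)\subset[0,1]$ on which $F$ is identically $0$, $N_t(x)=N_0(x)$ for all $t\ge0$ and $x\in[c,d)$, and so $N_\infty(x)=N_0(x)$.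
   Context: $\mathcal{P}_2(\mathbb{R})$ is the set of Borel probability measures on $\mathbb{R}$ with finite second moment; $\mathcal{L}$ is Lebesgue measure on $(0,1)$. The optimal map of a probability measure $\mu$ on $\mathbb{R}$ is the unique nondecreasing right-continuous function $N$ on $(0,1)$ with $N_\#\mathcal{L}=\mu$ (push-forward). The pressureless Euler system in one dimension is $\partial_t\rho+\partial_y(\rho v)=0$, $\partial_t(\rho v)+\partial_y(\rho v^2)=0$. Let $\mathcal{K}\subset L^2(0,1)$ be the closed convex cone of (a.e. classes of) nondecreasing functions and $\operatorname{proj}_{\mathcal K}$ the $L^2(0,1)$-orthogonal projection onto $\mathcal K$. It is computed by $\operatorname{proj}_{\mathcal K}f(x)=\frac{d^+}{dx}\Phi^{**}(x)$, where $\Phi(x)=\int_0^x f(w)\,dw$, $\Phi^{**}$ is the convex envelope of $\Phi$ on $[0,1]$ (greatest convex function bounded above by $\Phi$), and $\frac{d^+}{dx}$ is the right derivative; this nondecreasing right-continuous representative is always used. "The sticky particle solution" originating at $(N_0,V_0)$ means the solution generated by the projection formula: $N_t=\operatorname{proj}_{\mathcal K}(N_0+tV_0)$ and $\rho_t=(N_t)_\#\mathcal{L}$ for $t\ge0$. $N_\infty\in L^2(0,1)$ denotes the limit of $N_t$ as $t\to\infty$, pointwise a.e. and in $L^1(0,1)$ (which exists under the stated hypothesis on $F$), taken in its nondecreasing right-continuous representative. Nondecreasing functions on $(0,1)$ are evaluated at the endpoint $0$ by their right limit (possibly $-\infty$). *)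

theory Defs
  imports "HOL-Probability.Probability"
begin

definition Leb01 :: "real measure"
  where "Leb01 = restrict_space lborel {0<..<1}"

definition P2 :: "real measure set"
  where "P2 = {\<mu>. prob_space \<mu> \<and> sets \<mu> = sets borel \<and> integrable \<mu> (\<lambda>x. x\<^sup>2)}"

definition L2 :: "real measure \<Rightarrow> (real \<Rightarrow> real) set"
  where "L2 M = {f \<in> borel_measurable M. integrable M (\<lambda>x. (f x)\<^sup>2)}"

(* Elements of L2(0,1) are represented by functions real => real whose values
   outside (0,1) are irrelevant throughout. *)

definition nondecreasing_rc :: "(real \<Rightarrow> real) \<Rightarrow> bool"
  where "nondecreasing_rc N \<longleftrightarrow>
    mono_on {0<..<1} N \<and> (\<forall>x\<in>{0<..<1}. continuous (at_right x) N)"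

definition optimal_map :: "real measure \<Rightarrow> (real \<Rightarrow> real) \<Rightarrow> bool"
  where "optimal_map \<mu> N \<longleftrightarrow> nondecreasing_rc N \<and> distr Leb01 borel N = \<mu>"

definition cone_K :: "(real \<Rightarrow> real) set"
  where "cone_K = {f \<in> L2 Leb01. \<exists>g. mono_on {0<..<1} g \<and> (AE x in Leb01. f x = g x)}"

(* N is the nondecreasing right-continuous representative of the orthogonal
   projection of f onto the closed convex cone K, i.e. of the point of K nearest
   to f in L2(0,1).  This determines N uniquely on (0,1). *)

definition is_proj_K :: "(real \<Rightarrow> real) \<Rightarrow> (real \<Rightarrow> real) \<Rightarrow> bool"
  where "is_proj_K f N \<longleftrightarrow>
    f \<in> L2 Leb01 \<and> N \<in> cone_K \<and> nondecreasing_rc N \<and>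
    (\<forall>g\<in>cone_K. (\<integral>x. (f x - N x)\<^sup>2 \<partial>Leb01) \<le> (\<integral>x. (f x - g x)\<^sup>2 \<partial>Leb01))"

definition sticky_particle_solution ::
  "(real \<Rightarrow> real) \<Rightarrow> (real \<Rightarrow> real) \<Rightarrow> (real \<Rightarrow> real \<Rightarrow> real) \<Rightarrow> (real \<Rightarrow> real measure) \<Rightarrow> bool"
  where "sticky_particle_solution N\<^sub>0 V\<^sub>0 N \<rho> \<longleftrightarrow>
    (\<forall>t\<ge>0. is_proj_K (\<lambda>x. N\<^sub>0 x + t * V\<^sub>0 x) (N t) \<and> \<rho> t = distr Leb01 borel (N t))"

definition large_time_limit :: "(real \<Rightarrow> real \<Rightarrow> real) \<Rightarrow> (real \<Rightarrow> real) \<Rightarrow> bool"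
  where "large_time_limit N Ninf \<longleftrightarrow>
    Ninf \<in> L2 Leb01 \<and> nondecreasing_rc Ninf \<and>
    (AE x in Leb01. ((\<lambda>t. N t x) \<longlongrightarrow> Ninf x) at_top) \<and>
    ((\<lambda>t. \<integral>x. \<bar>N t x - Ninf x\<bar> \<partial>Leb01) \<longlongrightarrow> 0) at_top"

(* Evaluation on [0,1) of a nondecreasing function on (0,1); the right limit
   at 0 may be -\<infinity>, whence the extended-real values. *)

definition val :: "(real \<Rightarrow> real) \<Rightarrow> real \<Rightarrow> ereal"
  where "val N x = (if x = 0 then Lim (at_right 0) (\<lambda>y. ereal (N y)) else ereal (N x))"

end

theory Submission imports Defs begin

text \<open>
  The whole argument is variational: the convex envelope is never formed, and the projection
  \<open>N\<close> of \<open>N0 + t V\<close> onto the cone of nondecreasing functions enters only through the inequality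
  \<open>\<integral> (N0 + t V - N) (g - N) \<le> 0\<close> for nondecreasing \<open>g\<close>, with competitors \<open>g\<close> that
  differ from \<open>N\<close> on one interval only.  The velocity \<open>V\<close> is controlled by one fact
  (\<open>integral_mult_mono_le\<close>): if the primitive \<open>F\<close> of \<open>V\<close> is nonnegative and vanishes at both ends
  of an interval, then \<open>\<integral> V h = - \<integral> F dh \<le> 0\<close> on that interval for every nondecreasing \<open>h\<close>,
  and the gain is at least \<open>\<delta>\<close> times the increment of \<open>h\<close> over any subinterval where \<open>F \<ge> \<delta>\<close>.

  Let \<open>F a = 0\<close>.  Cutting \<open>N\<close> off at the level \<open>N0 a\<close>, from above on \<open>(0,a)\<close> or from below on
  \<open>(a,1)\<close>, would strictly improve the approximation unless it changes nothing; hence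
  \<open>N \<le> N0 a\<close> to the left of \<open>a\<close> and \<open>N \<ge> N0 a\<close> to the right (\<open>le_before_touching\<close>,
  \<open>ge_after_touching\<close>).  If \<open>F\<close> vanishes on a whole interval, these bounds at all of its points
  squeeze \<open>N\<close> onto \<open>N0\<close>, which is the second claim.

  For the first claim, raising and lowering \<open>N\<close> to the left of \<open>a\<close> shows that no momentum is
  exchanged across a zero of \<open>F\<close>, so that the centre of mass of each side stays put:
  \<open>\<integral>\<^sub>0\<^sup>a N = \<integral>\<^sub>0\<^sup>a N0\<close> (\<open>primitive_eq_at_touching\<close>).  So on an excursion
  \<open>(a,b)\<close> of \<open>F\<close> the mean of \<open>N\<close> is that of \<open>N0\<close> at all times.  Replacing \<open>N\<close> by this mean on
  \<open>(a,b)\<close> is an admissible competitor, and the variational inequality then bounds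
  \<open>t \<delta> (N x2 - N x1)\<close> by the integral over \<open>(a,b)\<close> of the squared deviation of \<open>N0\<close> from its mean, independently of \<open>t\<close>
  (\<open>relaxation\<close>).  Letting \<open>t\<close> tend to infinity, the limit is constant on \<open>(a,b)\<close>, and by
  \<open>L\<^sup>1\<close> convergence the constant is the mean of \<open>N0\<close>.
\<close>

section \<open>Pairing a function with a nondecreasing function\<close>

text \<open>Up to the single point \<open>Inf U\<close>, an upper part of an interval is again an interval.\<close>

lemma set_integral_upper_set:
  fixes V :: "real \<Rightarrow> real"
  assumes V: "set_integrable lborel {a<..<b} V"
    and U: "U \<subseteq> {a<..<b}" "U \<noteq> {}"
    and up: "\<And>x y. x \<in> U \<Longrightarrow> x \<le> y \<Longrightarrow> y < b \<Longrightarrow> y \<in> U"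
  shows "(LINT x:U|lborel. V x) = (LINT x:{Inf U<..<b}|lborel. V x)"
proof -
  let ?y = "Inf U"
  have bdd: "bdd_below U" using U(1) by (intro bdd_belowI[of _ a]) auto
  have sub1: "{?y<..<b} \<subseteq> U"
  proof
    fix z assume z: "z \<in> {?y<..<b}"
    then obtain x where "x \<in> U" "x < z" using cInf_lessD[OF U(2), of z] by auto
    then show "z \<in> U" using up[of x z] z by auto
  qed
  have sub2: "U \<subseteq> {?y..<b}" using cInf_lower[OF _ bdd] U(1) by auto
  have "U = {?y<..<b} \<union> (U \<inter> {?y})" using sub1 sub2 by force
  moreover have "U \<inter> {?y} \<in> sets borel" by (cases "?y \<in> U") auto
  ultimately have Um: "U \<in> sets lborel"
    by (metis borel_open open_greaterThanLessThan sets_lborel sets.Un)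
  show ?thesis
  proof (rule set_integral_cong_set)
    show "set_borel_measurable lborel U V" "set_borel_measurable lborel {?y<..<b} V"
      using set_integrable_subset[OF V Um U(1)] set_integrable_subset[OF V, of "{?y<..<b}"] sub1 U(1)
      by (auto simp: set_integrable_def set_borel_measurable_def)
    show "AE x in lborel. (x \<in> {?y<..<b}) = (x \<in> U)"
      using AE_lborel_singleton[of ?y] by eventually_elim (use sub1 sub2 in force)
  qed
qed

text \<open>The layer cake function: \<open>layer y s\<close> is the sign of \<open>y\<close> for \<open>s\<close> between \<open>0\<close> and
  \<open>y\<close>, so that \<open>y\<close> is the integral of \<open>layer y\<close>. Unlike the indicator of \<open>s < y\<close> it is integrable.\<close>

definition layer :: "real \<Rightarrow> real \<Rightarrow> real"
  where "layer y s = indicator {0..<y} s - indicator {y..<0} s"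

lemma layer_eq: "layer y s = (if s < y then 1 else 0) - (if s < 0 then 1 else 0)"
  by (auto simp: layer_def indicator_def)

lemma emeasure_lborel_Ico_eq: "emeasure lborel {x..<y} = ennreal (max 0 (y - x))" for x y :: real
  by (cases "x \<le> y") auto

lemma integrable_layer [simp]: "integrable lborel (layer y)"
  unfolding layer_def by (intro Bochner_Integration.integrable_diff) (auto simp: emeasure_lborel_Ico_eq)

lemma integral_layer [simp]: "(LBINT s. layer y s) = y"
  unfolding layer_def
  by (subst Bochner_Integration.integral_diff; cases "0 \<le> y")
    (auto simp: emeasure_lborel_Ico_eq measure_def ennreal_neg)

lemma integral_abs_layer: "(LBINT s. \<bar>layer y s\<bar>) = \<bar>y\<bar>"
proof (cases "y \<ge> 0")
  case True
  then have "\<And>s. \<bar>layer y s\<bar> = layer y s" by (auto simp: layer_def indicator_def)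
  with True show ?thesis by simp
next
  case False
  then have "\<And>s. \<bar>layer y s\<bar> = - layer y s" by (auto simp: layer_def indicator_def)
  with False show ?thesis by simp
qed

text \<open>Integration by parts against \<open>dh\<close> without Stieltjes integrals. Writing \<open>h\<close> as a superposition
  of indicators of its superlevel sets, Fubini turns \<open>\<integral> V h\<close> into an integral over the levels
  of integrals of \<open>V\<close> over upper parts \<open>(y,b)\<close>, each of which is \<open>\<le> 0\<close>. The levels between
  \<open>h x1\<close> and \<open>h x2\<close> have their threshold \<open>y\<close> in \<open>[x1,x2]\<close> and contribute at most \<open>- \<delta>\<close>
  each. This covers \<open>h\<close> that is unbounded near the endpoints.\<close>

lemma integral_mult_mono_le:
  fixes V h :: "real \<Rightarrow> real"
  assumes V: "set_integrable lborel {a<..<b} V"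
    and Vh: "set_integrable lborel {a<..<b} (\<lambda>x. V x * h x)"
    and h: "mono_on {a<..<b} h"
    and total: "(LINT x:{a<..<b}|lborel. V x) = 0"
    and tail: "\<And>y. y \<in> {a<..<b} \<Longrightarrow> (LINT x:{y<..<b}|lborel. V x) \<le> 0"
    and x12: "a < x1" "x1 \<le> x2" "x2 < b"
    and tail': "\<And>y. y \<in> {x1..x2} \<Longrightarrow> (LINT x:{y<..<b}|lborel. V x) \<le> - \<delta>"
  shows "(LINT x:{a<..<b}|lborel. V x * h x) \<le> - \<delta> * (h x2 - h x1)"
proof -
  define W where "W x = indicator {a<..<b} x * V x" for x
  \<comment> \<open>Extending \<open>h\<close> by zero is harmless because \<open>W\<close> vanishes outside the interval.\<close>
  define H where "H x = indicator {a<..<b} x * h x" for x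
  have Wi: "integrable lborel W" using V by (simp add: set_integrable_def W_def[abs_def])
  then have Wm [measurable]: "W \<in> borel_measurable borel" by simp
  have Hm [measurable]: "H \<in> borel_measurable borel"
    using borel_measurable_mono_on_fnc[OF h]
    by (subst (asm) borel_measurable_restrict_space_iff) (auto simp: H_def[abs_def])
  have WH: "W x * H x = indicator {a<..<b} x * (V x * h x)" for x
    by (auto simp: W_def H_def indicator_def)
  have WHi: "integrable lborel (\<lambda>x. W x * H x)"
    using Vh by (simp add: WH set_integrable_def)
  have meas: "(\<lambda>(x, s). W x * layer (H x) s) \<in> borel_measurable (lborel \<Otimes>\<^sub>M lborel)"
    unfolding layer_eq by measurable
  have int2: "integrable (lborel \<Otimes>\<^sub>M lborel) (\<lambda>(x, s). W x * layer (H x) s)"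
  proof (rule lborel_pair.Fubini_integrable[OF meas])
    have "(LBINT s. norm (case (x, s) of (x, s) \<Rightarrow> W x * layer (H x) s)) = \<bar>W x * H x\<bar>" for x
      by (simp add: abs_mult integral_abs_layer)
    then show "integrable lborel (\<lambda>x. LBINT s. norm (case (x, s) of (x, s) \<Rightarrow> W x * layer (H x) s))"
      using WHi by simp
  qed simp
  have W0: "(LBINT x. W x) = 0" using total by (simp add: W_def set_lebesgue_integral_def)
  define T where "T s = (LBINT x. W x * layer (H x) s)" for s
  have Ti: "integrable lborel T"
    unfolding T_def using lborel_pair.integrable_snd[of "\<lambda>x s. W x * layer (H x) s"] int2 by simp
  have T_le: "T s \<le> - \<delta> * indicator {h x1..<h x2} s" for s
  proof -
    define U where "U = {x \<in> {a<..<b}. s < h x}"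
    have up: "y \<in> U" if "x \<in> U" "x \<le> y" "y < b" for x y
      using that mono_onD[OF h, of x y] by (auto simp: U_def)
    have "integrable lborel (\<lambda>x. W x * (if s < H x then 1 else 0))"
      by (rule Bochner_Integration.integrable_bound[OF Wi]) auto
    then have "T s = (LBINT x. W x * (if s < H x then 1 else 0)) - (LBINT x. W x) * (if s < 0 then 1 else 0)"
      unfolding T_def layer_eq right_diff_distrib using Wi by (subst Bochner_Integration.integral_diff) auto
    also have "(LBINT x. W x * (if s < H x then 1 else 0)) = (LINT x:U|lborel. V x)"
      unfolding set_lebesgue_integral_def
      by (rule Bochner_Integration.integral_cong) (auto simp: W_def H_def U_def indicator_def)
    finally have T: "T s = (LINT x:U|lborel. V x)" using W0 by simp
    show ?thesis
    proof (cases "U = {}")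
      case True
      then have "s \<notin> {h x1..<h x2}" using x12 by (auto simp: U_def)
      then show ?thesis using T True by (simp add: set_lebesgue_integral_def)
    next
      case False
      have sub: "U \<subseteq> {a<..<b}" by (auto simp: U_def)
      have bdd: "bdd_below U" using sub by (intro bdd_belowI[of _ a]) auto
      let ?y = "Inf U"
      have T': "T s = (LINT x:{?y<..<b}|lborel. V x)"
        unfolding T by (rule set_integral_upper_set[OF V sub False up])
      have y: "a \<le> ?y" "?y < b"
        using sub False cInf_lower[OF _ bdd] by (auto intro!: cInf_greatest simp: subset_eq) fastforce+
      show ?thesis
      proof (cases "s \<in> {h x1..<h x2}")
        case True
        have "x2 \<in> U" using True x12 by (auto simp: U_def)
        then have "?y \<le> x2" by (rule cInf_lower[OF _ bdd])
        moreover have "x1 \<le> ?y"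
        proof (rule cInf_greatest[OF False])
          fix x assume x: "x \<in> U"
          show "x1 \<le> x"
          proof (rule ccontr)
            assume "\<not> x1 \<le> x"
            then have "x1 \<in> U" using up[OF x, of x1] x12 by auto
            then show False using True by (auto simp: U_def)
          qed
        qed
        ultimately show ?thesis using tail'[of ?y] T' True by simp
      next
        case False
        then show ?thesis using T' y tail[of ?y] total by (cases "?y = a") auto
      qed
    qed
  qed
  have "(LINT x:{a<..<b}|lborel. V x * h x) = (LBINT x. W x * H x)"
    by (simp add: set_lebesgue_integral_def WH)
  also have "\<dots> = (LBINT x. LBINT s. W x * layer (H x) s)" by simp
  also have "\<dots> = (LBINT s. T s)"
    unfolding T_def by (rule lborel_pair.Fubini_integral[OF int2, symmetric])
  also have "\<dots> \<le> (LBINT s. - \<delta> * indicator {h x1..<h x2} s)"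
    by (rule integral_mono[OF Ti _ T_le]) (auto simp: emeasure_lborel_Ico_eq)
  also have "\<dots> = - \<delta> * (h x2 - h x1)"
    using mono_onD[OF h, of x1 x2] x12 by (simp add: measure_def emeasure_lborel_Ico_eq)
  finally show ?thesis .
qed

section \<open>Square integrable functions on the unit interval\<close>

lemma space_Leb01 [simp]: "space Leb01 = {0<..<1}"
  by (simp add: Leb01_def space_restrict_space)

lemma finite_measure_Leb01: "finite_measure Leb01"
  by (rule finite_measureI) (simp add: Leb01_def emeasure_restrict_space space_restrict_space)

lemma measurable_Leb01: "f \<in> borel_measurable borel \<Longrightarrow> f \<in> borel_measurable Leb01"
  unfolding Leb01_def by (rule measurable_restrict_space1) simp

lemma integrable_Leb01_iff: "integrable Leb01 (h :: real \<Rightarrow> real) \<longleftrightarrow> set_integrable lborel {0<..<1} h"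
  unfolding Leb01_def set_integrable_def by (rule integrable_restrict_space) simp

lemma integral_Leb01: "(\<integral>x. (h x :: real) \<partial>Leb01) = (LINT x:{0<..<1}|lborel. h x)"
  unfolding Leb01_def set_lebesgue_integral_def by (rule integral_restrict_space) simp

lemma integral_Leb01_indicator:
  assumes "A \<subseteq> {0<..<1}"
  shows "(\<integral>x. indicator A x * h x \<partial>Leb01) = (LINT x:A|lborel. h x :: real)"
  unfolding integral_Leb01 set_lebesgue_integral_def
  by (rule Bochner_Integration.integral_cong) (use assms in \<open>auto simp: indicator_def\<close>)

lemma L2_dominated:
  assumes "g \<in> L2 Leb01" "f \<in> borel_measurable Leb01" "\<And>x. x \<in> {0<..<1} \<Longrightarrow> \<bar>f x\<bar> \<le> \<bar>g x\<bar>"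
  shows "f \<in> L2 Leb01"
proof -
  have "integrable Leb01 (\<lambda>x. (f x)\<^sup>2)"
  proof (rule Bochner_Integration.integrable_bound)
    show "integrable Leb01 (\<lambda>x. (g x)\<^sup>2)" using assms(1) by (simp add: L2_def)
    show "(\<lambda>x. (f x)\<^sup>2) \<in> borel_measurable Leb01" using assms(2) by measurable
    show "AE x in Leb01. norm ((f x)\<^sup>2) \<le> norm ((g x)\<^sup>2)"
      using assms(3) by (intro AE_I2) (simp add: abs_le_square_iff)
  qed
  with assms(2) show ?thesis by (simp add: L2_def)
qed

lemma L2_measurable: "f \<in> L2 M \<Longrightarrow> f \<in> borel_measurable M" by (simp add: L2_def)

lemma L2_mult_integrable:
  assumes "f \<in> L2 M" "g \<in> L2 M"
  shows "integrable M (\<lambda>x. f x * g x)"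
proof (rule Bochner_Integration.integrable_bound)
  show "integrable M (\<lambda>x. (f x)\<^sup>2 + (g x)\<^sup>2)" using assms by (simp add: L2_def)
  show "(\<lambda>x. f x * g x) \<in> borel_measurable M" using assms[THEN L2_measurable] by measurable
  have "\<bar>u * v\<bar> \<le> u\<^sup>2 + v\<^sup>2" for u v :: real
    using sum_squares_bound[of "\<bar>u\<bar>" "\<bar>v\<bar>"] abs_ge_zero[of "u * v"]
    unfolding abs_mult mult.assoc power2_abs by linarith
  then show "AE x in M. norm (f x * g x) \<le> norm ((f x)\<^sup>2 + (g x)\<^sup>2)" by simp
qed

lemma L2_add:
  assumes "f \<in> L2 M" "g \<in> L2 M"
  shows "(\<lambda>x. f x + g x) \<in> L2 M"
proof -
  have "integrable M (\<lambda>x. (f x)\<^sup>2 + (g x)\<^sup>2 + 2 * (f x * g x))"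
    using assms L2_mult_integrable[OF assms] by (simp add: L2_def)
  also have "(\<lambda>x. (f x)\<^sup>2 + (g x)\<^sup>2 + 2 * (f x * g x)) = (\<lambda>x. (f x + g x)\<^sup>2)"
    by (simp add: power2_sum mult.assoc)
  finally show ?thesis using assms[THEN L2_measurable] by (simp add: L2_def)
qed

lemma L2_cmult: "f \<in> L2 M \<Longrightarrow> (\<lambda>x. c * f x) \<in> L2 M"
  unfolding L2_def by (auto simp: power_mult_distrib intro!: borel_measurable_times)

lemma L2_diff:
  assumes "f \<in> L2 M" "g \<in> L2 M"
  shows "(\<lambda>x. f x - g x) \<in> L2 M"
proof -
  have "(\<lambda>x. f x + (-1) * g x) \<in> L2 M" by (rule L2_add[OF assms(1) L2_cmult[OF assms(2)]])
  then show ?thesis by simp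
qed

lemma L2_const: "(\<lambda>x. c) \<in> L2 Leb01"
  using finite_measure.integrable_const[OF finite_measure_Leb01] by (simp add: L2_def)

lemma L2_set_integrable_mult:
  assumes "f \<in> L2 Leb01" "g \<in> L2 Leb01" "A \<in> sets borel" "A \<subseteq> {0<..<1}"
  shows "set_integrable lborel A (\<lambda>x. f x * g x)"
  using set_integrable_subset[of lborel "{0<..<1}" "\<lambda>x. f x * g x" A] L2_mult_integrable[OF assms(1,2)] assms(3,4)
  by (simp add: integrable_Leb01_iff)

lemma L2_set_integrable:
  assumes "f \<in> L2 Leb01" "A \<in> sets borel" "A \<subseteq> {0<..<1}"
  shows "set_integrable lborel A f"
  using L2_set_integrable_mult[OF assms(1) L2_const[of 1] assms(2,3)] by simp

lemma cone_K_I: "g \<in> L2 Leb01 \<Longrightarrow> mono_on {0<..<1} g \<Longrightarrow> g \<in> cone_K"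
  by (auto simp: cone_K_def)

text \<open>The first-order condition for the nearest point of a convex set: moving from \<open>N\<close> a small way
  towards \<open>g\<close> must not decrease the distance to \<open>f\<close>.\<close>

lemma proj_variational:
  assumes P: "is_proj_K f N" and g: "g \<in> L2 Leb01" "mono_on {0<..<1} g"
  shows "(\<integral>x. (f x - N x) * (g x - N x) \<partial>Leb01) \<le> 0"
proof -
  have f: "f \<in> L2 Leb01" and N: "N \<in> L2 Leb01" "mono_on {0<..<1} N"
    using P by (simp_all add: is_proj_K_def cone_K_def nondecreasing_rc_def)
  have opt: "(\<integral>x. (f x - N x)\<^sup>2 \<partial>Leb01) \<le> (\<integral>x. (f x - g x)\<^sup>2 \<partial>Leb01)" if "g \<in> cone_K" for g
    using P that unfolding is_proj_K_def by blast
  have r: "(\<lambda>x. f x - N x) \<in> L2 Leb01" and k: "(\<lambda>x. g x - N x) \<in> L2 Leb01"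
    using f g N by (auto intro: L2_diff)
  let ?I = "\<integral>x. (f x - N x) * (g x - N x) \<partial>Leb01"
  let ?Q = "\<integral>x. (g x - N x)\<^sup>2 \<partial>Leb01"
  have ineq: "2 * ?I \<le> e * ?Q" if e: "0 < e" "e \<le> 1" for e
  proof -
    have "(\<lambda>x. N x + e * (g x - N x)) \<in> L2 Leb01"
      by (rule L2_add[OF N(1) L2_cmult[OF k]])
    moreover have "mono_on {0<..<1} (\<lambda>x. N x + e * (g x - N x))"
    proof (rule mono_onI)
      fix x y :: real assume xy: "x \<in> {0<..<1}" "y \<in> {0<..<1}" "x \<le> y"
      have "(1 - e) * N x + e * g x \<le> (1 - e) * N y + e * g y"
        using e mono_onD[OF N(2) xy] mono_onD[OF g(2) xy] by (intro add_mono mult_left_mono) auto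
      then show "N x + e * (g x - N x) \<le> N y + e * (g y - N y)" by (simp add: algebra_simps)
    qed
    ultimately have "(\<integral>x. (f x - N x)\<^sup>2 \<partial>Leb01) \<le> (\<integral>x. (f x - (N x + e * (g x - N x)))\<^sup>2 \<partial>Leb01)"
      by (intro opt cone_K_I)
    also have "\<dots> = (\<integral>x. (f x - N x)\<^sup>2 - (2 * e) * ((f x - N x) * (g x - N x)) + e\<^sup>2 * (g x - N x)\<^sup>2 \<partial>Leb01)"
      by (rule Bochner_Integration.integral_cong) (auto simp: power2_eq_square algebra_simps)
    also have "\<dots> = (\<integral>x. (f x - N x)\<^sup>2 \<partial>Leb01) - 2 * e * ?I + e\<^sup>2 * ?Q"
      using r k L2_mult_integrable[OF r k] by (simp add: L2_def)
    finally have "e * (2 * ?I) \<le> e * (e * ?Q)" by (simp add: power2_eq_square algebra_simps)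
    then show ?thesis using e by simp
  qed
  have "((\<lambda>e. e * ?Q) \<longlongrightarrow> 0 * ?Q) (at_right 0)" by (intro tendsto_intros)
  moreover have "\<forall>\<^sub>F e in at_right 0. 2 * ?I \<le> e * ?Q"
    by (rule eventually_at_rightI[of 0 1]) (use ineq in auto)
  ultimately have "2 * ?I \<le> 0 * ?Q" by (rule tendsto_lowerbound) simp
  then show ?thesis by simp
qed

lemma proj_variational_on:
  assumes P: "is_proj_K f N" and A: "A \<in> sets borel" "A \<subseteq> {0<..<1}" and k: "k \<in> L2 Leb01"
    and mono: "mono_on {0<..<1} (\<lambda>x. if x \<in> A then N x + k x else N x)"
  shows "(LINT x:A|lborel. (f x - N x) * k x) \<le> 0"
proof -
  have N: "N \<in> L2 Leb01" using P by (auto simp: is_proj_K_def cone_K_def)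
  have "indicator A \<in> borel_measurable Leb01" using A(1) by (intro measurable_Leb01) simp
  then have "(\<lambda>x. indicator A x * k x) \<in> borel_measurable Leb01"
    using L2_measurable[OF k] by (rule borel_measurable_times)
  then have "(\<lambda>x. indicator A x * k x) \<in> L2 Leb01"
    by (rule L2_dominated[OF k]) (simp add: indicator_def)
  then have "(\<lambda>x. N x + indicator A x * k x) \<in> L2 Leb01" by (rule L2_add[OF N])
  moreover have eq: "(\<lambda>x. N x + indicator A x * k x) = (\<lambda>x. if x \<in> A then N x + k x else N x)"
    by (auto simp: indicator_def)
  ultimately have "(\<integral>x. (f x - N x) * ((N x + indicator A x * k x) - N x) \<partial>Leb01) \<le> 0"
    by (intro proj_variational[OF P]) (simp_all only: eq mono)
  then show ?thesis using integral_Leb01_indicator[OF A(2), of "\<lambda>x. (f x - N x) * k x"]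
    by (simp add: mult.left_commute)
qed

section \<open>Primitives and right-continuous representatives\<close>

definition primitive :: "(real \<Rightarrow> real) \<Rightarrow> real \<Rightarrow> real"
  where "primitive V x = (LINT w:{0<..<x}|lborel. V w)"

lemma primitive_0 [simp]: "primitive V 0 = 0"
  by (simp add: primitive_def set_lebesgue_integral_def)

lemma primitive_diff:
  assumes V: "V \<in> L2 Leb01" and y: "0 \<le> y" "y < b" "b \<le> 1"
  shows "(LINT x:{y<..<b}|lborel. V x) = primitive V b - primitive V y"
proof (cases "y = 0")
  case False
  then have y0: "0 < y" using y by simp
  have Vi: "set_integrable lborel A V" if "A \<in> sets borel" "A \<subseteq> {0<..<b}" for A
    using that y by (intro L2_set_integrable[OF V]) auto
  have "{0<..<b} = {0<..<y} \<union> {y..<b}" using y y0 by auto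
  then have "primitive V b = primitive V y + (LINT x:{y..<b}|lborel. V x)"
    unfolding primitive_def using y y0 by (simp, intro set_integral_Un Vi) auto
  also have "(LINT x:{y..<b}|lborel. V x) = (LINT x:{y<..<b}|lborel. V x)"
    using set_integral_upper_set[of 0 b V "{y..<b}"] Vi y y0 by (simp add: subset_eq)
  finally show ?thesis by simp
qed (simp add: primitive_def[of V b])

lemma continuous_on_primitive:
  assumes V: "V \<in> L2 Leb01"
  shows "continuous_on {0..1} (primitive V)"
proof -
  have Vi: "set_integrable lborel {0<..<x} V" if "x \<le> 1" for x
    using that by (intro L2_set_integrable[OF V]) auto
  have "V integrable_on {0<..<1}" using Vi[of 1] by (rule set_borel_integral_eq_integral) simp
  then have "V integrable_on {0..1}" using integrable_on_open_interval[of V 0 1] by (simp add: box_real)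
  then have "continuous_on {0..1} (\<lambda>x. integral {0..x} V)"
    by (rule indefinite_integral_continuous_1)
  moreover have "primitive V x = integral {0..x} V" if "x \<in> {0..1}" for x
    unfolding primitive_def using that integral_open_interval[of 0 x V]
    by (subst set_borel_integral_eq_integral[OF Vi]) (auto simp: box_real)
  ultimately show ?thesis using continuous_on_cong[OF refl, of "{0..1}" "primitive V"] by metis
qed

lemma right_limit_rc:
  assumes "nondecreasing_rc N" "x \<in> {0<..<1}"
  shows "(N \<longlongrightarrow> N x) (at_right x)"
  using assms by (auto simp: nondecreasing_rc_def continuous_within)

lemma right_continuous_ge:
  assumes N: "nondecreasing_rc N" and x: "x \<in> {0<..<1}" and "x < d"
    and ge: "\<And>y. y \<in> {x<..<d} \<Longrightarrow> c \<le> N y"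
  shows "c \<le> N x"
proof (rule tendsto_lowerbound[OF right_limit_rc[OF N x]])
  show "\<forall>\<^sub>F y in at_right x. c \<le> N y"
    using \<open>x < d\<close> ge by (rule eventually_at_rightI[rotated]) 
qed simp

lemma square_integral_pos:
  fixes k :: "real \<Rightarrow> real"
  assumes k: "k \<in> L2 Leb01" and pq: "0 \<le> p" "q \<le> 1" and uv: "p \<le> u" "u < v" "v \<le> q"
    and e: "0 < e" "\<And>y. y \<in> {u<..<v} \<Longrightarrow> e \<le> \<bar>k y\<bar>"
  shows "0 < (LINT x:{p<..<q}|lborel. k x * k x)"
proof -
  have sub: "{p<..<q} \<subseteq> {0<..<1}" using pq by auto
  have "0 < (v - u) * e\<^sup>2" using uv e(1) by simp
  also have "\<dots> = (LBINT x. indicator {u<..<v} x * e\<^sup>2)" using uv by simp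
  also have "\<dots> \<le> (LBINT x. indicator {p<..<q} x * (k x * k x))"
  proof (rule integral_mono)
    show "integrable lborel (\<lambda>x. indicator {u<..<v} x * e\<^sup>2)" using uv by simp
    show "integrable lborel (\<lambda>x. indicator {p<..<q} x * (k x * k x))"
      using L2_set_integrable_mult[OF k k _ sub] by (simp add: set_integrable_def)
    show "indicator {u<..<v} x * e\<^sup>2 \<le> indicator {p<..<q} x * (k x * k x)" for x
      using uv e(2)[of x] e(1) abs_le_square_iff[of e "k x"] by (auto simp: indicator_def power2_eq_square)
  qed
  finally show ?thesis by (simp add: set_lebesgue_integral_def)
qed

section \<open>The projection at a fixed time\<close>

text \<open>Where the nonnegative primitive of \<open>V\<close> vanishes, the primitive of \<open>N0 + t V\<close> touches its
  minorant, the convex primitive of \<open>N0\<close>. Zeros of \<open>primitive V\<close> are therefore called touching points.\<close>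

locale touching_data =
  fixes N0 V :: "real \<Rightarrow> real"
  assumes N0: "N0 \<in> L2 Leb01" "nondecreasing_rc N0"
    and V: "V \<in> L2 Leb01"
    and F_nonneg: "x \<in> {0..1} \<Longrightarrow> 0 \<le> primitive V x"
begin

lemma N0_mono: "0 < x \<Longrightarrow> x \<le> y \<Longrightarrow> y < 1 \<Longrightarrow> N0 x \<le> N0 y"
  using N0(2) by (auto simp: nondecreasing_rc_def mono_on_def)

text \<open>Here the integral of \<open>V\<close> over \<open>(y,b)\<close> is \<open>- primitive V y\<close>, since the primitive vanishes at \<open>b\<close>.\<close>

lemma pairing_le:
  assumes ab: "0 \<le> a" "b \<le> 1" and F: "primitive V a = 0" "primitive V b = 0"
    and h: "h \<in> L2 Leb01" "mono_on {a<..<b} h"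
    and x12: "a < x1" "x1 \<le> x2" "x2 < b"
    and \<delta>: "\<And>y. y \<in> {x1..x2} \<Longrightarrow> \<delta> \<le> primitive V y"
  shows "(LINT x:{a<..<b}|lborel. V x * h x) \<le> - \<delta> * (h x2 - h x1)"
proof (rule integral_mult_mono_le[OF _ _ h(2) _ _ x12])
  have sub: "{a<..<b} \<subseteq> {0<..<1}" using ab by auto
  show "set_integrable lborel {a<..<b} V" "set_integrable lborel {a<..<b} (\<lambda>x. V x * h x)"
    using L2_set_integrable[OF V _ sub] L2_set_integrable_mult[OF V h(1) _ sub] by auto
  show "(LINT x:{a<..<b}|lborel. V x) = 0" using primitive_diff[OF V, of a b] ab x12 F by simp
  fix y
  have tail: "(LINT x:{y<..<b}|lborel. V x) = - primitive V y" if "a < y" "y < b"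
    using primitive_diff[OF V, of y b] ab that F by simp
  show "(LINT x:{y<..<b}|lborel. V x) \<le> 0" if "y \<in> {a<..<b}"
    using tail F_nonneg[of y] ab that by simp
  show "(LINT x:{y<..<b}|lborel. V x) \<le> - \<delta>" if "y \<in> {x1..x2}"
    using tail \<delta>[OF that] x12 that by simp
qed

lemma pairing_nonpos:
  assumes ab: "0 \<le> a" "a < b" "b \<le> 1" and F: "primitive V a = 0" "primitive V b = 0"
    and h: "h \<in> L2 Leb01" "mono_on {a<..<b} h"
  shows "(LINT x:{a<..<b}|lborel. V x * h x) \<le> 0"
  using pairing_le[OF ab(1,3) F h, of "(a + b) / 2" "(a + b) / 2" 0] ab F_nonneg by simp

end

locale projected_step = touching_data +
  fixes t :: real and N :: "real \<Rightarrow> real"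
  assumes t: "0 \<le> t" and proj: "is_proj_K (\<lambda>x. N0 x + t * V x) N"
    and F1: "primitive V 1 = 0"
begin

lemma N_L2: "N \<in> L2 Leb01" and N_rc: "nondecreasing_rc N"
  using proj by (auto simp: is_proj_K_def cone_K_def)

lemma N_mono: "0 < x \<Longrightarrow> x \<le> y \<Longrightarrow> y < 1 \<Longrightarrow> N x \<le> N y"
  using N_rc by (auto simp: nondecreasing_rc_def mono_on_def)

text \<open>The variational inequality for a competitor that differs from \<open>N\<close> by \<open>k\<close> on one interval,
  with the contribution of the velocity split off.\<close>

lemma variation:
  assumes k: "k \<in> L2 Leb01" and ab: "0 \<le> a" "a < b" "b \<le> 1"
    and mono: "mono_on {0<..<1} (\<lambda>x. if x \<in> {a<..<b} then N x + k x else N x)"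
  shows "(LINT x:{a<..<b}|lborel. (N0 x - N x) * k x) + t * (LINT x:{a<..<b}|lborel. V x * k x) \<le> 0"
proof -
  have sub: "{a<..<b} \<subseteq> {0<..<1}" using ab by auto
  have i1: "set_integrable lborel {a<..<b} (\<lambda>x. (N0 x - N x) * k x)"
    by (rule L2_set_integrable_mult[OF L2_diff[OF N0(1) N_L2] k _ sub]) simp
  have i2: "set_integrable lborel {a<..<b} (\<lambda>x. t * (V x * k x))"
    using L2_set_integrable_mult[OF V k _ sub] by simp
  have "(LINT x:{a<..<b}|lborel. (N0 x + t * V x - N x) * k x)
      = (LINT x:{a<..<b}|lborel. (N0 x - N x) * k x + t * (V x * k x))"
    by (simp add: algebra_simps)
  also have "\<dots> = (LINT x:{a<..<b}|lborel. (N0 x - N x) * k x) + t * (LINT x:{a<..<b}|lborel. V x * k x)"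
    using set_integral_add(2)[OF i1 i2] by simp
  finally show ?thesis using proj_variational_on[OF proj _ sub k mono] by simp
qed

text \<open>If the perturbation is nonincreasing and the interval is bounded by zeros of the primitive, the
  velocity term has the sign that allows it to be discarded, so time disappears from the inequality.\<close>

lemma variation_decreasing:
  assumes k: "k \<in> L2 Leb01" and ab: "0 \<le> a" "a < b" "b \<le> 1"
    and F: "primitive V a = 0" "primitive V b = 0"
    and mono: "mono_on {0<..<1} (\<lambda>x. if x \<in> {a<..<b} then N x + k x else N x)"
    and anti: "mono_on {a<..<b} (\<lambda>x. - k x)"
  shows "(LINT x:{a<..<b}|lborel. (N0 x - N x) * k x) \<le> 0"
proof -
  have "(\<lambda>x. - k x) \<in> L2 Leb01" using L2_cmult[OF k, of "-1"] by simp
  then have "(LINT x:{a<..<b}|lborel. V x * - k x) \<le> 0"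
    using anti by (rule pairing_nonpos[OF ab F])
  moreover have "(LINT x:{a<..<b}|lborel. V x * - k x) = - (LINT x:{a<..<b}|lborel. V x * k x)"
    by (simp add: set_lebesgue_integral_def)
  ultimately have "0 \<le> t * (LINT x:{a<..<b}|lborel. V x * k x)" using t by simp
  then show ?thesis using variation[OF k ab mono] by simp
qed

text \<open>Where \<open>N\<close> exceeds \<open>c = N0 a\<close> on \<open>(0,a)\<close> it also exceeds \<open>N0\<close>, by at least \<open>N - c\<close>.
  Cutting \<open>N\<close> off at \<open>c\<close> moves it towards \<open>N0\<close>, and by \<open>variation_decreasing\<close> this is only
  compatible with optimality if the excess \<open>N - c\<close> has zero square integral.\<close>

lemma le_before_touching:
  assumes a: "a \<in> {0<..<1}" "primitive V a = 0" and x: "x \<in> {0<..<a}"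
  shows "N x \<le> N0 a"
proof (rule ccontr)
  let ?c = "N0 a"
  assume "\<not> N x \<le> ?c"
  then have gt: "?c < N x" by simp
  define k where "k x = min (N x) ?c - N x" for x
  have km: "k \<in> borel_measurable Leb01" using L2_measurable[OF N_L2] unfolding k_def by measurable
  have k: "k \<in> L2 Leb01"
    by (rule L2_dominated[OF L2_diff[OF N_L2 L2_const[of ?c]] km]) (auto simp: k_def)
  have sub: "{0<..<a} \<subseteq> {0<..<1}" using a by auto
  have "mono_on {0<..<1} (\<lambda>x. if x \<in> {0<..<a} then N x + k x else N x)"
  proof (rule mono_onI)
    fix x y :: real assume "x \<in> {0<..<1}" "y \<in> {0<..<1}" "x \<le> y"
    then show "(if x \<in> {0<..<a} then N x + k x else N x) \<le> (if y \<in> {0<..<a} then N y + k y else N y)"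
      using N_mono[of x y] by (auto simp: k_def min_def)
  qed
  then have "(LINT x:{0<..<a}|lborel. (N0 x - N x) * k x) \<le> 0"
  proof (rule variation_decreasing[OF k, rotated 5])
    show "mono_on {0<..<a} (\<lambda>x. - k x)"
    proof (rule mono_onI)
      fix x y :: real assume "x \<in> {0<..<a}" "y \<in> {0<..<a}" "x \<le> y"
      then show "- k x \<le> - k y" using N_mono[of x y] a by (auto simp: k_def min_def)
    qed
  qed (use a in auto)
  moreover have "(LINT x:{0<..<a}|lborel. k x * k x) \<le> (LINT x:{0<..<a}|lborel. (N0 x - N x) * k x)"
  proof (rule set_integral_mono)
    show "set_integrable lborel {0<..<a} (\<lambda>x. k x * k x)"
      "set_integrable lborel {0<..<a} (\<lambda>x. (N0 x - N x) * k x)"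
      by (intro L2_set_integrable_mult k L2_diff N0(1) N_L2 sub; simp)+
    fix x assume "x \<in> {0<..<a}"
    then have "N0 x \<le> ?c" using N0_mono[of x a] a by simp
    then show "k x * k x \<le> (N0 x - N x) * k x"
      by (auto simp: k_def min_def intro: mult_right_mono_neg)
  qed
  moreover have "0 < (LINT x:{0<..<a}|lborel. k x * k x)"
  proof (rule square_integral_pos[OF k, of 0 a x a "N x - ?c"])
    show "N x - ?c \<le> \<bar>k y\<bar>" if "y \<in> {x<..<a}" for y
      using that N_mono[of x y] gt a x by (auto simp: k_def)
  qed (use a x gt in auto)
  ultimately show False by simp
qed

text \<open>The mirror image of \<open>le_before_touching\<close>. Right continuity adds the point \<open>a\<close> itself, which
  has no counterpart on the left.\<close>

lemma ge_after_touching: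
  assumes a: "a \<in> {0<..<1}" "primitive V a = 0" and x: "x \<in> {a..<1}"
  shows "N0 a \<le> N x"
proof -
  let ?c = "N0 a"
  define k where "k x = max (N x) ?c - N x" for x
  have km: "k \<in> borel_measurable Leb01" using L2_measurable[OF N_L2] unfolding k_def by measurable
  have k: "k \<in> L2 Leb01"
    by (rule L2_dominated[OF L2_diff[OF N_L2 L2_const[of ?c]] km]) (auto simp: k_def)
  have sub: "{a<..<1} \<subseteq> {0<..<1}" using a by auto
  have "mono_on {0<..<1} (\<lambda>x. if x \<in> {a<..<1} then N x + k x else N x)"
  proof (rule mono_onI)
    fix x y :: real assume "x \<in> {0<..<1}" "y \<in> {0<..<1}" "x \<le> y"
    then show "(if x \<in> {a<..<1} then N x + k x else N x) \<le> (if y \<in> {a<..<1} then N y + k y else N y)"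
      using N_mono[of x y] by (auto simp: k_def max_def)
  qed
  then have I: "(LINT x:{a<..<1}|lborel. (N0 x - N x) * k x) \<le> 0"
  proof (rule variation_decreasing[OF k, rotated 5])
    show "mono_on {a<..<1} (\<lambda>x. - k x)"
    proof (rule mono_onI)
      fix x y :: real assume "x \<in> {a<..<1}" "y \<in> {a<..<1}" "x \<le> y"
      then show "- k x \<le> - k y" using N_mono[of x y] a by (auto simp: k_def max_def)
    qed
  qed (use a F1 in auto)
  have II: "(LINT x:{a<..<1}|lborel. k x * k x) \<le> (LINT x:{a<..<1}|lborel. (N0 x - N x) * k x)"
  proof (rule set_integral_mono)
    show "set_integrable lborel {a<..<1} (\<lambda>x. k x * k x)"
      "set_integrable lborel {a<..<1} (\<lambda>x. (N0 x - N x) * k x)"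
      by (intro L2_set_integrable_mult k L2_diff N0(1) N_L2 sub; simp)+
    fix x assume "x \<in> {a<..<1}"
    then have "?c \<le> N0 x" using N0_mono[of a x] a by simp
    then show "k x * k x \<le> (N0 x - N x) * k x"
      by (auto simp: k_def max_def intro: mult_right_mono)
  qed
  have right: "?c \<le> N y" if y: "y \<in> {a<..<1}" for y
  proof (rule ccontr)
    assume "\<not> ?c \<le> N y"
    then have lt: "N y < ?c" by simp
    have "0 < (LINT x:{a<..<1}|lborel. k x * k x)"
    proof (rule square_integral_pos[OF k, of a 1 a y "?c - N y"])
      show "?c - N y \<le> \<bar>k z\<bar>" if "z \<in> {a<..<y}" for z
        using that N_mono[of z y] lt a y by (auto simp: k_def)
    qed (use a y lt in auto)
    with I II show False by simp
  qed
  show ?thesis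
  proof (cases "x = a")
    case True
    then show ?thesis using right_continuous_ge[OF N_rc a(1), of 1] right a by auto
  qed (use right x in auto)
qed

text \<open>No momentum is exchanged across a zero \<open>a\<close> of the primitive, and the total momentum on
  \<open>(0,a)\<close> is zero, so the centre of mass of this part does not move. Lowering \<open>N\<close> by a constant on
  \<open>(0,a)\<close> keeps it nondecreasing and gives one inequality. For the other one, if \<open>a < 1\<close>, \<open>N\<close> must be raised on
  \<open>(0,a)\<close>, which is allowed only up to the level \<open>c = N0 a\<close>, a lower bound for \<open>N\<close> on the right
  of \<open>a\<close>: raise it by \<open>min e (c - N)\<close>. Where this is less than \<open>e\<close>, the bound \<open>N0 \<le> c\<close>
  gives \<open>N0 - N < e\<close>, so the error made is of order \<open>e\<close>.\<close>

lemma primitive_eq_at_touching: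
  assumes a: "a \<in> {0..1}" "primitive V a = 0"
  shows "primitive N a = primitive N0 a"
proof -
  consider "a = 0" | "0 < a" by (use a in fastforce)
  then show ?thesis
  proof cases
    case 2
    have sub: "{0<..<a} \<subseteq> {0<..<1}" using a by auto
    have N0i: "set_integrable lborel {0<..<a} N0" and Ni: "set_integrable lborel {0<..<a} N"
      by (intro L2_set_integrable N0(1) N_L2 sub; simp)+
    have diff: "(LINT x:{0<..<a}|lborel. N0 x - N x) = primitive N0 a - primitive N a"
      unfolding primitive_def using N0i Ni by (rule set_integral_diff)
    have shift: "(LINT x:{0<..<a}|lborel. (N0 x - N x) * c) = c * (primitive N0 a - primitive N a)" 
      "(LINT x:{0<..<a}|lborel. V x * c) = 0" for c
      using diff a(2) by (simp_all add: primitive_def mult.commute)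
    have "mono_on {0<..<1} (\<lambda>x. if x \<in> {0<..<a} then N x + - 1 else N x)"
    proof (rule mono_onI)
      fix x y :: real assume "x \<in> {0<..<1}" "y \<in> {0<..<1}" "x \<le> y"
      then show "(if x \<in> {0<..<a} then N x + - 1 else N x) \<le> (if y \<in> {0<..<a} then N y + - 1 else N y)"
        using N_mono[of x y] by auto
    qed
    then have "primitive N a \<le> primitive N0 a"
      using variation[OF L2_const[of "-1"], of 0 a] a 2 by (simp only: shift) simp
    moreover have "primitive N0 a \<le> primitive N a"
    proof (cases "a = 1")
      case True
      have "mono_on {0<..<1} (\<lambda>x. if x \<in> {0<..<a} then N x + 1 else N x)"
      proof (rule mono_onI)
        fix x y :: real assume "x \<in> {0<..<1}" "y \<in> {0<..<1}" "x \<le> y"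
        then show "(if x \<in> {0<..<a} then N x + 1 else N x) \<le> (if y \<in> {0<..<a} then N y + 1 else N y)"
          using N_mono[of x y] True by auto
      qed
      then show ?thesis
        using variation[OF L2_const[of 1], of 0 a] a 2 by (simp only: shift) simp
    next
      case False
      then have a01: "a \<in> {0<..<1}" using 2 a by auto
      let ?c = "N0 a"
      have "primitive N0 a - primitive N a \<le> e" if e: "0 < e" for e
      proof -
        define k where "k x = min e (?c - N x)" for x
        have le: "N x \<le> ?c" if "x \<in> {0<..<a}" for x by (rule le_before_touching[OF a01 a(2) that])
        have km: "k \<in> borel_measurable Leb01" using L2_measurable[OF N_L2] unfolding k_def by measurable
        have "(\<lambda>x. \<bar>e\<bar> + \<bar>?c - N x\<bar>) \<in> L2 Leb01"
        proof (rule L2_add[OF L2_const])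
          have "(\<lambda>x. ?c - N x) \<in> L2 Leb01" by (rule L2_diff[OF L2_const N_L2])
          then show "(\<lambda>x. \<bar>?c - N x\<bar>) \<in> L2 Leb01"
            by (rule L2_dominated) (auto intro!: borel_measurable_abs L2_measurable[OF L2_diff] L2_const N_L2)
        qed
        then have k: "k \<in> L2 Leb01" by (rule L2_dominated[OF _ km]) (auto simp: k_def)
        have "mono_on {0<..<1} (\<lambda>x. if x \<in> {0<..<a} then N x + k x else N x)"
        proof (rule mono_onI)
          fix x y :: real assume "x \<in> {0<..<1}" "y \<in> {0<..<1}" "x \<le> y"
          then show "(if x \<in> {0<..<a} then N x + k x else N x) \<le> (if y \<in> {0<..<a} then N y + k y else N y)"
            using N_mono[of x y] ge_after_touching[OF a01 a(2), of y] by (auto simp: k_def min_def)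
        qed
        then have I: "(LINT x:{0<..<a}|lborel. (N0 x - N x) * k x) \<le> 0"
        proof (rule variation_decreasing[OF k, rotated 5])
          show "mono_on {0<..<a} (\<lambda>x. - k x)"
          proof (rule mono_onI)
            fix x y :: real assume "x \<in> {0<..<a}" "y \<in> {0<..<a}" "x \<le> y"
            then show "- k x \<le> - k y" using N_mono[of x y] a by (auto simp: k_def min_def)
          qed
        qed (use a01 a in auto)
        have ki: "set_integrable lborel {0<..<a} (\<lambda>x. (1 / e) * ((N0 x - N x) * k x))"
          using L2_set_integrable_mult[OF L2_diff[OF N0(1) N_L2] k _ sub] by simp
        have ei: "set_integrable lborel {0<..<a} (\<lambda>x. e)"
          by (rule L2_set_integrable[OF L2_const _ sub]) simp
        have "primitive N0 a - primitive N a \<le> (LINT x:{0<..<a}|lborel. (1 / e) * ((N0 x - N x) * k x) + e)"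
          unfolding diff[symmetric]
        proof (rule set_integral_mono)
          show "set_integrable lborel {0<..<a} (\<lambda>x. N0 x - N x)"
            using N0i Ni by (rule set_integral_diff)
          show "set_integrable lborel {0<..<a} (\<lambda>x. (1 / e) * ((N0 x - N x) * k x) + e)"
            using ki ei by (rule set_integral_add)
          fix x assume x: "x \<in> {0<..<a}"
          have N0c: "N0 x \<le> ?c" using x a01 N0_mono[of x a] by auto
          show "N0 x - N x \<le> (1 / e) * ((N0 x - N x) * k x) + e"
          proof (cases "e \<le> ?c - N x")
            case True
            then have "k x = e" by (simp add: k_def)
            then show ?thesis using e by simp
          next
            case False
            then have kx: "k x = ?c - N x" by (simp add: k_def)
            \<comment> \<open>\<open>r\<close> is the fraction of the full shift \<open>e\<close> that the perturbation achieves at \<open>x\<close>.\<close>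
            define r where "r = k x / e"
            have r: "0 \<le> r" "r \<le> 1" using False e le[OF x] by (auto simp: r_def kx)
            have "N0 x - N x \<le> e" using False N0c by simp
            then have "(N0 x - N x) * (1 - r) \<le> e * (1 - r)" using r by (intro mult_right_mono) auto
            also have "\<dots> \<le> e" using r e by (simp add: mult_left_le)
            finally show ?thesis using e by (simp add: r_def algebra_simps)
          qed
        qed
        also have "\<dots> = (1 / e) * (LINT x:{0<..<a}|lborel. (N0 x - N x) * k x) + a * e"
          using set_integral_add(2)[OF ki ei] 2 by (simp add: set_lebesgue_integral_def)
        also have "\<dots> \<le> e"
        proof -
          have "(1 / e) * (LINT x:{0<..<a}|lborel. (N0 x - N x) * k x) \<le> 0"
            using I e by (simp add: divide_nonpos_pos)
          moreover have "a * e \<le> e" using e a by simp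
          ultimately show ?thesis by linarith
        qed
        finally show ?thesis .
      qed
      then show ?thesis using field_le_epsilon[of "primitive N0 a" "primitive N a"] by (simp add: algebra_simps)
    qed
    ultimately show ?thesis by simp
  qed simp
qed

text \<open>Compare \<open>N\<close> with its own mean \<open>m\<close> over \<open>(a,b)\<close>, which equals the mean of \<open>N0\<close>. The velocity
  term is at least \<open>t \<delta> (N x2 - N x1)\<close>, while the remaining term is bounded by completing the square;
  the bound does not depend on \<open>t\<close>.\<close>

lemma relaxation:
  assumes ab: "0 \<le> a" "a < b" "b \<le> 1" and F: "primitive V a = 0" "primitive V b = 0"
    and m: "m = (primitive N0 b - primitive N0 a) / (b - a)"
    and x12: "a < x1" "x1 \<le> x2" "x2 < b"
    and \<delta>: "\<And>y. y \<in> {x1..x2} \<Longrightarrow> \<delta> \<le> primitive V y"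
  shows "t * (\<delta> * (N x2 - N x1)) \<le> (LINT x:{a<..<b}|lborel. (N0 x - m) * (N0 x - m))"
proof -
  have sub: "{a<..<b} \<subseteq> {0<..<1}" using ab by auto
  have Ni: "set_integrable lborel {a<..<b} N" by (rule L2_set_integrable[OF N_L2 _ sub]) simp
  have ci: "set_integrable lborel {a<..<b} (\<lambda>x. c)" for c :: real
    by (rule L2_set_integrable[OF L2_const _ sub]) simp
  have const: "(LINT x:{a<..<b}|lborel. c) = (b - a) * c" for c :: real
    using ab by (simp add: set_lebesgue_integral_def)
  have mean: "(LINT x:{a<..<b}|lborel. N x) = (b - a) * m"
    using primitive_diff[OF N_L2 ab] primitive_eq_at_touching ab F by (simp add: m)
  have lo: "N x \<le> m" if "0 < x" "x \<le> a" for x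
  proof -
    have "(b - a) * N x \<le> (LINT y:{a<..<b}|lborel. N y)" unfolding const[symmetric]
      by (rule set_integral_mono[OF ci Ni]) (use N_mono that ab in auto)
    then show ?thesis using mean ab by simp
  qed
  have hi: "m \<le> N y" if "b \<le> y" "y < 1" for y
  proof -
    have "(LINT y:{a<..<b}|lborel. N y) \<le> (b - a) * N y" unfolding const[symmetric]
      by (rule set_integral_mono[OF Ni ci]) (use N_mono that ab in auto)
    then show ?thesis using mean ab by simp
  qed
  define k where "k x = m - N x" for x
  have k: "k \<in> L2 Leb01" unfolding k_def by (rule L2_diff[OF L2_const N_L2])
  have "mono_on {0<..<1} (\<lambda>x. if x \<in> {a<..<b} then N x + k x else N x)"
  proof (rule mono_onI)
    fix x y :: real assume "x \<in> {0<..<1}" "y \<in> {0<..<1}" "x \<le> y"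
    then show "(if x \<in> {a<..<b} then N x + k x else N x) \<le> (if y \<in> {a<..<b} then N y + k y else N y)"
      using N_mono[of x y] lo[of x] hi[of y] by (auto simp: k_def)
  qed
  then have var: "(LINT x:{a<..<b}|lborel. (N0 x - N x) * k x) + t * (LINT x:{a<..<b}|lborel. V x * k x) \<le> 0"
    using ab by (intro variation k) auto
  have prod: "set_integrable lborel {a<..<b} (\<lambda>x. (N0 x - N x) * k x)"
    by (rule L2_set_integrable_mult[OF L2_diff[OF N0(1) N_L2] k _ sub]) simp
  have "(LINT x:{a<..<b}|lborel. V x * (- k x)) \<le> - \<delta> * (- k x2 - - k x1)"
  proof (rule pairing_le[OF ab(1,3) F _ _ x12 \<delta>])
    show "(\<lambda>x. - k x) \<in> L2 Leb01" using L2_cmult[OF k, of "-1"] by simp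
    show "mono_on {a<..<b} (\<lambda>x. - k x)"
    proof (rule mono_onI)
      fix x y :: real assume "x \<in> {a<..<b}" "y \<in> {a<..<b}" "x \<le> y"
      then show "- k x \<le> - k y" using N_mono[of x y] ab by (auto simp: k_def)
    qed
  qed
  moreover have "(LINT x:{a<..<b}|lborel. V x * - k x) = - (LINT x:{a<..<b}|lborel. V x * k x)"
    by (simp add: set_lebesgue_integral_def)
  ultimately have "\<delta> * (N x2 - N x1) \<le> (LINT x:{a<..<b}|lborel. V x * k x)" by (simp add: k_def)
  then have "t * (\<delta> * (N x2 - N x1)) \<le> t * (LINT x:{a<..<b}|lborel. V x * k x)"
    using t by (rule mult_left_mono)
  also have "\<dots> \<le> - (LINT x:{a<..<b}|lborel. (N0 x - N x) * k x)" using var by simp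
  also have "\<dots> = (LINT x:{a<..<b}|lborel. - ((N0 x - N x) * k x))"
    by (rule set_integral_uminus[OF prod, symmetric])
  also have "\<dots> \<le> (LINT x:{a<..<b}|lborel. (N0 x - m) * (N0 x - m))"
  proof (rule set_integral_mono)
    show "set_integrable lborel {a<..<b} (\<lambda>x. - ((N0 x - N x) * k x))"
      using prod by (simp add: set_integrable_def)
    show "set_integrable lborel {a<..<b} (\<lambda>x. (N0 x - m) * (N0 x - m))"
      by (intro L2_set_integrable_mult L2_diff N0(1) L2_const sub) simp
    fix x
    \<comment> \<open>\<open>- (w + k) k = w\<^sup>2 / 4 - (w / 2 + k)\<^sup>2\<close> for \<open>w = N0 x - m\<close>.\<close>
    have "0 \<le> ((N0 x - m) / 2 + k x)\<^sup>2 + 3 / 4 * (N0 x - m)\<^sup>2" by simp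
    then show "- ((N0 x - N x) * k x) \<le> (N0 x - m) * (N0 x - m)"
      by (simp add: k_def power2_eq_square field_simps)
  qed
  finally show ?thesis .
qed

end

section \<open>The limit as time tends to infinity\<close>

lemma AE_Leb01_dense:
  assumes "AE x in Leb01. P x" and uv: "0 \<le> u" "u < v" "v \<le> 1"
  obtains z where "z \<in> {u<..<v}" "P z"
proof -
  have ae: "AE x in lborel. x \<in> {0<..<1} \<longrightarrow> P x"
    using assms(1) unfolding Leb01_def by (subst (asm) AE_restrict_space_iff) auto
  have "\<exists>z\<in>{u<..<v}. P z"
  proof (rule ccontr)
    assume neg: "\<not> (\<exists>z\<in>{u<..<v}. P z)"
    have "AE x in lborel. x \<notin> {u<..<v}"
      using ae by eventually_elim (use neg uv in force)
    then have "{u<..<v} \<in> null_sets lborel" by (subst AE_iff_null_sets) auto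
    then show False using uv by (auto simp: null_sets_def)
  qed
  then show ?thesis using that by blast
qed

text \<open>Between \<open>x\<close> and any later point there is a point where the two functions agree, so
  monotonicity and right continuity transfer the comparison to \<open>x\<close>.\<close>

lemma rc_le_of_AE_eq:
  assumes N: "nondecreasing_rc N" and N': "nondecreasing_rc N'" and cd: "0 \<le> c" "d \<le> 1"
    and eq: "AE z in Leb01. z \<in> {c<..<d} \<longrightarrow> N z = N' z" and x: "x \<in> {c<..<d}"
  shows "N x \<le> N' x"
proof (rule right_continuous_ge[OF N', of x d])
  fix y assume y: "y \<in> {x<..<d}"
  obtain z where z: "z \<in> {x<..<y}" "z \<in> {c<..<d} \<longrightarrow> N z = N' z"
    using AE_Leb01_dense[OF eq, of x y] x y cd by auto
  have "N x \<le> N z" using N x y z(1) cd by (auto simp: nondecreasing_rc_def mono_on_def)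
  also have "N z = N' z" using x y z by auto
  also have "\<dots> \<le> N' y" using N' x y z(1) cd by (auto simp: nondecreasing_rc_def mono_on_def)
  finally show "N x \<le> N' y" .
qed (use x cd in auto)

text \<open>Values on \<open>[c,d)\<close>, including the left endpoint (and the possibly infinite value at \<open>0\<close>), are
  determined by the values on \<open>(c,d)\<close>.\<close>

lemma val_cong:
  assumes N: "nondecreasing_rc N" and N': "nondecreasing_rc N'" and cd: "0 \<le> c" "d \<le> 1"
    and eq: "\<And>z. z \<in> {c<..<d} \<Longrightarrow> N z = N' z" and x: "x \<in> {c..<d}"
  shows "val N x = val N' x"
proof -
  have ev: "\<forall>\<^sub>F z in at_right x. N z = N' z"
    using x eq by (intro eventually_at_rightI[of x d]) auto
  show ?thesis
  proof (cases "x = 0")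
    case True
    have "Lim (at_right 0) (\<lambda>y. ereal (N y)) = Lim (at_right 0) (\<lambda>y. ereal (N' y))"
      by (rule Lim_cong) (use ev True in \<open>auto elim: eventually_mono\<close>)
    then show ?thesis by (simp add: val_def True)
  next
    case False
    then have x01: "x \<in> {0<..<1}" using x cd by auto
    have "(N \<longlongrightarrow> N' x) (at_right x)"
      using right_limit_rc[OF N' x01] tendsto_cong[OF ev] by blast
    then have "N x = N' x" using right_limit_rc[OF N x01] by (intro tendsto_unique) auto
    then show ?thesis using False by (simp add: val_def)
  qed
qed

lemma val_const: "val (\<lambda>_. c) x = ereal c"
  by (simp add: val_def tendsto_Lim)

text \<open>This is where \<open>L\<^sup>1\<close> convergence is used: it makes the primitives converge.\<close>

lemma primitive_large_time_limit:
  assumes lim: "large_time_limit N Ninf" and L2: "\<And>t. 0 \<le> t \<Longrightarrow> N t \<in> L2 Leb01"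
    and a: "0 \<le> a" "a \<le> 1" and const: "\<And>t. 0 \<le> t \<Longrightarrow> primitive (N t) a = p"
  shows "primitive Ninf a = p"
proof -
  have sub: "{0<..<a} \<subseteq> {0<..<1}" using a by auto
  have Ninf: "Ninf \<in> L2 Leb01" using lim by (simp add: large_time_limit_def)
  have "((\<lambda>t. \<integral>x. \<bar>N t x - Ninf x\<bar> \<partial>Leb01) \<longlongrightarrow> 0) at_top" using lim by (simp add: large_time_limit_def)
  moreover have "\<forall>\<^sub>F t in at_top. \<bar>p - primitive Ninf a\<bar> \<le> (\<integral>x. \<bar>N t x - Ninf x\<bar> \<partial>Leb01)"
    using eventually_ge_at_top[of 0]
  proof eventually_elim
    fix t :: real assume t: "0 \<le> t"
    have D: "(\<lambda>x. N t x - Ninf x) \<in> L2 Leb01" by (rule L2_diff[OF L2[OF t] Ninf])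
    have i: "set_integrable lborel A (N t)" "set_integrable lborel A Ninf" "set_integrable lborel A (\<lambda>x. N t x - Ninf x)"
      if "A \<in> sets borel" "A \<subseteq> {0<..<1}" for A
      using that by (auto intro!: L2_set_integrable L2[OF t] Ninf D)
    have "p - primitive Ninf a = (LINT x:{0<..<a}|lborel. N t x - Ninf x)"
      unfolding const[OF t, symmetric] primitive_def using i[OF _ sub] by (simp add: set_integral_diff)
    also have "\<bar>\<dots>\<bar> \<le> (LBINT x. \<bar>indicator {0<..<a} x * (N t x - Ninf x)\<bar>)"
      unfolding set_lebesgue_integral_def real_scaleR_def by (rule integral_abs_bound)
    also have "\<dots> \<le> (LBINT x. indicator {0<..<1} x * \<bar>N t x - Ninf x\<bar>)"
    proof (rule integral_mono)
      show "integrable lborel (\<lambda>x. \<bar>indicator {0<..<a} x * (N t x - Ninf x)\<bar>)"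
        using i(3)[OF _ sub] by (simp add: set_integrable_def)
      show "integrable lborel (\<lambda>x. indicator {0<..<1} x * \<bar>N t x - Ninf x\<bar>)"
        using set_integrable_abs[OF i(3)[of "{0<..<1}"]] by (simp add: set_integrable_def)
    qed (use a in \<open>auto simp: indicator_def\<close>)
    also have "\<dots> = (\<integral>x. \<bar>N t x - Ninf x\<bar> \<partial>Leb01)"
      by (simp add: integral_Leb01 set_lebesgue_integral_def)
    finally show "\<bar>p - primitive Ninf a\<bar> \<le> (\<integral>x. \<bar>N t x - Ninf x\<bar> \<partial>Leb01)" .
  qed
  ultimately have "\<bar>p - primitive Ninf a\<bar> \<le> 0" by (intro tendsto_lowerbound) auto
  then show ?thesis by simp
qed

locale projected_flow = touching_data +
  fixes N :: "real \<Rightarrow> real \<Rightarrow> real" and Ninf :: "real \<Rightarrow> real"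
  assumes proj: "0 \<le> t \<Longrightarrow> is_proj_K (\<lambda>x. N0 x + t * V x) (N t)"
    and F1: "primitive V 1 = 0"
    and lim: "large_time_limit N Ninf"
begin

lemma step: "0 \<le> t \<Longrightarrow> projected_step N0 V t (N t)"
  by unfold_locales (simp_all add: proj F1)

lemma Ninf_rc: "nondecreasing_rc Ninf" and Ninf_L2: "Ninf \<in> L2 Leb01"
  and Ninf_lim: "AE x in Leb01. ((\<lambda>t. N t x) \<longlongrightarrow> Ninf x) at_top"
  using lim by (simp_all add: large_time_limit_def)

lemma Ninf_mono: "0 < x \<Longrightarrow> x \<le> y \<Longrightarrow> y < 1 \<Longrightarrow> Ninf x \<le> Ninf y"
  using Ninf_rc by (auto simp: nondecreasing_rc_def mono_on_def)

text \<open>Every point of the interval is a zero of the primitive. The lower bound at \<open>x\<close> comes from \<open>x\<close>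
  itself; the upper bound comes from the points to the right of \<open>x\<close> and the right continuity of
  \<open>N0\<close>.\<close>

lemma unchanged_on_zero_interval:
  assumes t: "0 \<le> t" and cd: "0 \<le> c" "d \<le> 1"
    and F: "\<And>y. y \<in> {c<..<d} \<Longrightarrow> primitive V y = 0" and x: "x \<in> {c<..<d}"
  shows "N t x = N0 x"
proof (rule antisym)
  interpret projected_step N0 V t "N t" by (rule step[OF t])
  have x01: "x \<in> {0<..<1}" using x cd by auto
  show "N0 x \<le> N t x" using ge_after_touching[OF x01 F[OF x], of x] x01 by simp
  show "N t x \<le> N0 x"
    by (rule right_continuous_ge[OF N0(2) x01, of d]) (use x cd in \<open>auto intro!: le_before_touching F\<close>)
qed

lemma limit_on_zero_interval:
  assumes cd: "0 \<le> c" "d \<le> 1"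
    and F: "\<And>y. y \<in> {c<..<d} \<Longrightarrow> primitive V y = 0" and x: "x \<in> {c<..<d}"
  shows "Ninf x = N0 x"
proof -
  have "AE z in Leb01. z \<in> {c<..<d} \<longrightarrow> Ninf z = N0 z"
    using Ninf_lim
  proof eventually_elim
    fix z assume l: "((\<lambda>t. N t z) \<longlongrightarrow> Ninf z) at_top"
    show "z \<in> {c<..<d} \<longrightarrow> Ninf z = N0 z"
    proof
      assume z: "z \<in> {c<..<d}"
      have "\<forall>\<^sub>F t in at_top. N t z = N0 z"
        using eventually_ge_at_top[of 0] by eventually_elim (rule unchanged_on_zero_interval[OF _ cd F z])
      then have "((\<lambda>t. N t z) \<longlongrightarrow> N0 z) at_top" by (rule tendsto_eventually)
      with l show "Ninf z = N0 z" by (intro tendsto_unique[of at_top]) auto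
    qed
  qed
  then have "Ninf x \<le> N0 x" "N0 x \<le> Ninf x"
    using rc_le_of_AE_eq[OF Ninf_rc N0(2) cd _ x] rc_le_of_AE_eq[OF N0(2) Ninf_rc cd _ x]
    by (auto simp: eq_commute)
  then show ?thesis by simp
qed

text \<open>The primitive is bounded below by some \<open>\<delta> > 0\<close> on every compact subinterval, so by
  \<open>relaxation\<close> the oscillation of \<open>N t\<close> there is of order \<open>1/t\<close>.\<close>

lemma limit_constant_on_excursion:
  assumes ab: "0 \<le> a" "b \<le> 1" and F: "primitive V a = 0" "primitive V b = 0"
    and pos: "\<And>y. y \<in> {a<..<b} \<Longrightarrow> 0 < primitive V y"
    and xy: "a < x" "x \<le> y" "y < b"
  shows "Ninf x = Ninf y"
proof (rule antisym)
  show "Ninf x \<le> Ninf y" using Ninf_mono xy ab by simp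
  obtain x1 where x1: "x1 \<in> {a<..<x}" "((\<lambda>t. N t x1) \<longlongrightarrow> Ninf x1) at_top"
    using AE_Leb01_dense[OF Ninf_lim, of a x] ab xy by auto
  obtain x2 where x2: "x2 \<in> {y<..<b}" "((\<lambda>t. N t x2) \<longlongrightarrow> Ninf x2) at_top"
    using AE_Leb01_dense[OF Ninf_lim, of y b] ab xy by auto
  have "continuous_on {x1..x2} (primitive V)"
    using continuous_on_subset[OF continuous_on_primitive[OF V]] x1 x2 ab by auto
  moreover have "{x1..x2} \<noteq> {}" using x1 x2 xy by auto
  ultimately obtain z where z: "z \<in> {x1..x2}" and zmin: "\<And>w. w \<in> {x1..x2} \<Longrightarrow> primitive V z \<le> primitive V w"
    using continuous_attains_inf[of "{x1..x2}" "primitive V"] by auto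
  define \<delta> where "\<delta> = primitive V z"
  have \<delta>: "0 < \<delta>" unfolding \<delta>_def using z x1 x2 by (intro pos) auto
  define m where "m = (primitive N0 b - primitive N0 a) / (b - a)"
  define C where "C = (LINT x:{a<..<b}|lborel. (N0 x - m) * (N0 x - m))"
  have "((\<lambda>t. \<delta> * (N t x2 - N t x1)) \<longlongrightarrow> \<delta> * (Ninf x2 - Ninf x1)) at_top"
    by (intro tendsto_intros x1 x2)
  moreover have "((\<lambda>t. C / t) \<longlongrightarrow> 0) at_top"
    by (intro tendsto_divide_0[OF tendsto_const] filterlim_at_top_imp_at_infinity filterlim_ident)
  moreover have "\<forall>\<^sub>F t in at_top. \<delta> * (N t x2 - N t x1) \<le> C / t"
    using eventually_gt_at_top[of 0]
  proof eventually_elim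
    fix t :: real assume t_pos: "0 < t"
    interpret projected_step N0 V t "N t" by (rule step) (use t_pos in simp)
    have "t * (\<delta> * (N t x2 - N t x1)) \<le> C"
      unfolding C_def using ab F x1 x2 xy zmin
      by (intro relaxation[OF _ _ _ _ _ m_def]) (auto simp: \<delta>_def)
    then show "\<delta> * (N t x2 - N t x1) \<le> C / t" using t_pos by (simp add: pos_le_divide_eq mult.commute)
  qed
  ultimately have "\<delta> * (Ninf x2 - Ninf x1) \<le> 0" by (intro tendsto_le) auto
  then have "Ninf x2 \<le> Ninf x1" using \<delta> by (simp add: mult_le_0_iff)
  then show "Ninf y \<le> Ninf x" using Ninf_mono[of x1 x] Ninf_mono[of y x2] x1 x2 xy ab by auto
qed

lemma limit_on_excursion:
  assumes ab: "0 \<le> a" "b \<le> 1" and F: "primitive V a = 0" "primitive V b = 0"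
    and pos: "\<And>y. y \<in> {a<..<b} \<Longrightarrow> 0 < primitive V y"
    and x: "x \<in> {a<..<b}"
  shows "Ninf x = (primitive N0 b - primitive N0 a) / (b - a)"
proof -
  have prim: "primitive Ninf c = primitive N0 c" if c: "c \<in> {0..1}" "primitive V c = 0" for c
  proof (rule primitive_large_time_limit[OF lim])
    fix t :: real assume "0 \<le> t"
    then interpret projected_step N0 V t "N t" by (rule step)
    show "N t \<in> L2 Leb01" by (rule N_L2)
    show "primitive (N t) c = primitive N0 c" by (rule primitive_eq_at_touching[OF c])
  qed (use c in auto)
  have const: "Ninf y = Ninf x" if "y \<in> {a<..<b}" for y
  proof (cases "x \<le> y")
    case True
    then show ?thesis using limit_constant_on_excursion[OF ab F pos, of x y] that x by simp
  next
    case False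
    then show ?thesis using limit_constant_on_excursion[OF ab F pos, of y x] that x by simp
  qed
  have "primitive N0 b - primitive N0 a = (LINT y:{a<..<b}|lborel. Ninf y)"
    using primitive_diff[OF Ninf_L2, of a b] prim[of a] prim[of b] ab F x by simp
  also have "\<dots> = (LINT y:{a<..<b}|lborel. Ninf x)"
    by (intro set_lebesgue_integral_cong) (simp_all add: const)
  also have "\<dots> = (b - a) * Ninf x" using x by (simp add: set_lebesgue_integral_def)
  finally show ?thesis using x by simp
qed

end

lemma interval_integral_eq_primitive:
  assumes "f \<in> L2 Leb01" "0 \<le> a" "a < b" "b \<le> 1"
  shows "(LBINT w=ereal a..ereal b. f w) = primitive f b - primitive f a"
  using primitive_diff[OF assms] assms by (simp add: interval_integral_Ioo)

theorem theorem3p12: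
  fixes \<rho>\<^sub>0 :: "real measure" and v\<^sub>0 N\<^sub>0 V\<^sub>0 F :: "real \<Rightarrow> real"
    and N :: "real \<Rightarrow> real \<Rightarrow> real" and \<rho> :: "real \<Rightarrow> real measure"
    and Ninf :: "real \<Rightarrow> real"
  assumes "\<rho>\<^sub>0 \<in> P2"
    and "v\<^sub>0 \<in> L2 \<rho>\<^sub>0"
    and "optimal_map \<rho>\<^sub>0 N\<^sub>0"
    and "V\<^sub>0 = v\<^sub>0 \<circ> N\<^sub>0"
    and "\<And>x. x \<in> {0..1} \<Longrightarrow> F x = (LBINT w=0..x. V\<^sub>0 w)"
    and "F 1 = 0"
    and "\<And>x. x \<in> {0<..<1} \<Longrightarrow> F x \<ge> 0"
    and "sticky_particle_solution N\<^sub>0 V\<^sub>0 N \<rho>"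
    and "large_time_limit N Ninf"
  shows "(\<forall>a b. 0 \<le> a \<and> a < b \<and> b \<le> 1 \<and> F a = 0 \<and> F b = 0 \<and> (\<forall>x\<in>{a<..<b}. F x > 0) \<longrightarrow>
            (\<forall>x\<in>{a..<b}. val Ninf x = ereal (1 / (b - a) * (LBINT w=a..b. N\<^sub>0 w)))) \<and>
         (\<forall>c d. 0 \<le> c \<and> c < d \<and> d \<le> 1 \<and> (\<forall>x\<in>{c..<d}. F x = 0) \<longrightarrow>
            (\<forall>x\<in>{c..<d}. (\<forall>t\<ge>0. val (N t) x = val N\<^sub>0 x) \<and> val Ninf x = val N\<^sub>0 x))"
proof -
  have proj: "is_proj_K (\<lambda>x. N\<^sub>0 x + t * V\<^sub>0 x) (N t)" if "0 \<le> t" for t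
    using assms(8) that by (simp add: sticky_particle_solution_def)
  have L2t: "(\<lambda>x. N\<^sub>0 x + t * V\<^sub>0 x) \<in> L2 Leb01" if "0 \<le> t" for t
    using proj[OF that] by (simp add: is_proj_K_def)
  \<comment> \<open>\<open>N\<^sub>0\<close> is the function projected at time 0, and \<open>V\<^sub>0\<close> is the difference of those projected at times 1 and 0.\<close>
  have N0_L2: "N\<^sub>0 \<in> L2 Leb01" using L2t[of 0] by simp
  have V0: "V\<^sub>0 \<in> L2 Leb01" using L2_diff[OF L2t[of 1] N0_L2] by simp
  have F: "F x = primitive V\<^sub>0 x" if "x \<in> {0..1}" for x
    using assms(5)[OF that] that
    by (simp add: interval_integral_Ioo primitive_def)
  have nonneg: "0 \<le> primitive V\<^sub>0 x" if "x \<in> {0..1}" for x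
    using that F[of x] assms(6) assms(7)[of x] by (cases "x = 0 \<or> x = 1") auto
  interpret projected_flow N\<^sub>0 V\<^sub>0 N Ninf
    by unfold_locales
      (use N0_L2 V0 nonneg proj assms(3,9) F[of 1] assms(6) in \<open>auto simp: optimal_map_def\<close>)
  have rc: "nondecreasing_rc (N t)" if "0 \<le> t" for t
    using proj[OF that] by (simp add: is_proj_K_def)
  have "val Ninf x = ereal (1 / (b - a) * (LBINT w=a..b. N\<^sub>0 w))"
    if ab: "0 \<le> a" "a < b" "b \<le> 1" and zero: "F a = 0" "F b = 0"
      and pos: "\<forall>x\<in>{a<..<b}. F x > 0" and x: "x \<in> {a..<b}" for a b x
  proof -
    let ?m = "(primitive N\<^sub>0 b - primitive N\<^sub>0 a) / (b - a)"
    have "Ninf z = ?m" if "z \<in> {a<..<b}" for z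
      by (rule limit_on_excursion[OF ab(1,3)]) (use that zero pos F ab in force)+
    then have "val Ninf x = val (\<lambda>_. ?m) x"
      by (intro val_cong[OF Ninf_rc _ ab(1,3) _ x]) (auto simp: nondecreasing_rc_def mono_on_def)
    also have "?m = 1 / (b - a) * (LBINT w=a..b. N\<^sub>0 w)"
      using interval_integral_eq_primitive[OF N0_L2 ab] by simp
    finally show ?thesis by (simp add: val_const)
  qed
  moreover have "(\<forall>t\<ge>0. val (N t) x = val N\<^sub>0 x) \<and> val Ninf x = val N\<^sub>0 x"
    if cd: "0 \<le> c" "c < d" "d \<le> 1" and zero: "\<forall>x\<in>{c..<d}. F x = 0" and x: "x \<in> {c..<d}" for c d x
  proof -
    have z: "primitive V\<^sub>0 y = 0" if "y \<in> {c<..<d}" for y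
      using that zero F[of y] cd by simp
    show ?thesis
      using val_cong[OF rc N0(2) cd(1,3) unchanged_on_zero_interval[OF _ cd(1,3) z] x]
        val_cong[OF Ninf_rc N0(2) cd(1,3) limit_on_zero_interval[OF cd(1,3) z] x]
      by blast
  qed
  ultimately show ?thesis by blast
qed

end
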